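(* Let $0<\alpha<1$ and let $G=(V,E)$ be a connected graph on $n$ nodes with minimum degree $\delta$. Then $1\le MD_{\alpha}(G)\le \left(\frac{\delta+\frac{1}{\alpha}}{\delta+1}\right)\alpha n$.
   Context: A configuration is a map $\mathcal{C}:V\to\{b,w\}$ (black/white). In $\alpha$-bootstrap percolation ($0<\alpha<1$), starting from $\mathcal{C}_0$, in each round $t\ge1$ all nodes update simultaneously: $\mathcal{C}_t(v)=b$ iff $\mathcal{C}_{t-1}(v)=b$ or the number of neighbors of $v$ that are black in $\mathcal{C}_{t-1}$ is at least $\alpha d(v)$, where $d(v)$ is the degree of $v$; otherwise $\mathcal{C}_t(v)=w$. A set $D\subseteq V$ is a dynamo if for every initial configuration in which all nodes of $D$ are black, eventually all nodes of $V$ are black. $MD_\alpha(G)$ is the minimum size of a dynamo in $\alpha$-bootstrap percolation on $G$.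
   Formalization: The lower bound 1 ≤ MD is stated only for n ≥ 2, because for the one-node graph the node has degree 0, turns black by itself, and MD = 0; the upper bound is stated for all n ≥ 1. *)

theory Defs
  imports Complex_Main "Graph_Theory.Digraph_Component"
begin

text \<open>
  Finite simple undirected graphs are those of the locale \<^locale>\<open>graph\<close>: finite, symmetric
  digraphs without loops and without parallel arcs. Each undirected edge at \<open>v\<close> contributes
  exactly one arc with tail \<open>v\<close>, so \<^const>\<open>out_degree\<close> is the degree of \<open>v\<close>.
\<close>

definition neighbors :: "('a, 'b) pre_digraph \<Rightarrow> 'a \<Rightarrow> 'a set" where
  "neighbors G v = {u. v \<rightarrow>\<^bsub>G\<^esub> u}"

definition min_degree :: "('a, 'b) pre_digraph \<Rightarrow> nat" where
  "min_degree G = Min (out_degree G ` verts G)"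

datatype colour = Black | White

type_synonym 'a configuration = "'a \<Rightarrow> colour"

definition bootstrap_step ::
    "real \<Rightarrow> ('a, 'b) pre_digraph \<Rightarrow> 'a configuration \<Rightarrow> 'a configuration" where
  "bootstrap_step \<alpha> G C v =
    (if C v = Black \<or> real (card {u \<in> neighbors G v. C u = Black}) \<ge> \<alpha> * real (out_degree G v)
     then Black else White)"

fun bootstrap ::
    "real \<Rightarrow> ('a, 'b) pre_digraph \<Rightarrow> 'a configuration \<Rightarrow> nat \<Rightarrow> 'a configuration" where
  "bootstrap \<alpha> G C 0 = C"
| "bootstrap \<alpha> G C (Suc t) = bootstrap_step \<alpha> G (bootstrap \<alpha> G C t)"

text \<open>
  Configurations are total functions on the vertex type, but only their values on
  \<^term>\<open>verts G\<close> influence the process on \<^term>\<open>verts G\<close>.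
\<close>

definition dynamo :: "real \<Rightarrow> ('a, 'b) pre_digraph \<Rightarrow> 'a set \<Rightarrow> bool" where
  "dynamo \<alpha> G D \<longleftrightarrow> D \<subseteq> verts G \<and>
    (\<forall>C. (\<forall>v\<in>D. C v = Black) \<longrightarrow>
      (\<exists>T. \<forall>t\<ge>T. \<forall>v\<in>verts G. bootstrap \<alpha> G C t v = Black))"

definition MD :: "real \<Rightarrow> ('a, 'b) pre_digraph \<Rightarrow> nat" where
  "MD \<alpha> G = Min (card ` {D. dynamo \<alpha> G D})"

text \<open>
  The minimum is attained: on a finite graph the set of sizes of dynamos is finite and,
  as the whole vertex set is a dynamo, nonempty.
\<close>

lemma bootstrap_Black_mono: "C v = Black \<Longrightarrow> bootstrap \<alpha> G C t v = Black"
  by (induction t) (auto simp: bootstrap_step_def)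

lemma dynamo_verts: "dynamo \<alpha> G (verts G)"
  by (auto simp: dynamo_def intro: bootstrap_Black_mono)

lemma MD_attained:
  assumes "finite (verts G)"
  shows "\<exists>D. dynamo \<alpha> G D \<and> card D = MD \<alpha> G"
proof -
  have "{D. dynamo \<alpha> G D} \<subseteq> Pow (verts G)"
    by (auto simp: dynamo_def)
  then have "finite (card ` {D. dynamo \<alpha> G D})"
    using assms by (meson finite_Pow_iff finite_imageI finite_subset)
  moreover have "card ` {D. dynamo \<alpha> G D} \<noteq> {}"
    using dynamo_verts by blast
  ultimately show ?thesis
    unfolding MD_def using Min_in by fastforce
qed

text \<open>
  A vertex of degree \<open>0\<close> turns black unconditionally (\<open>0 \<ge> \<alpha> \<cdot> 0\<close>), so on a one-vertex graph
  the empty set is a dynamo.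
\<close>

lemma MD_single_vertex:
  assumes "verts G = {v}" and "arcs G = {}"
  shows "MD \<alpha> G = 0"
proof -
  have deg: "out_degree G v = 0"
    using assms by (simp add: out_degree_def out_arcs_def)
  have "bootstrap \<alpha> G C t v = Black" if "t \<ge> 1" for C t
    using that by (cases t) (auto simp: bootstrap_step_def deg)
  then have "dynamo \<alpha> G {}"
    unfolding dynamo_def using assms(1) by auto
  moreover have "finite (card ` {D. dynamo \<alpha> G D})"
    by (rule finite_imageI, rule finite_subset[of _ "Pow (verts G)"])
      (auto simp: dynamo_def assms(1))
  ultimately have "MD \<alpha> G \<le> card ({} :: 'a set)"
    unfolding MD_def by (intro Min_le imageI) auto
  then show ?thesis by simp
qed

end

theory Submission
  imports Defs
begin

text \<open>
  Order the vertices uniformly at random and seed every vertex \<open>v\<close> preceded by fewer than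
  \<open>\<lceil>\<alpha> d(v)\<rceil>\<close> of its neighbours; the other vertices then turn black one after another. The number
  of neighbours preceding \<open>v\<close> is uniform on \<open>{0..d(v)}\<close>, so \<open>v\<close> is a seed with probability at most
  \<open>(\<alpha> d(v) + 1) / (d(v) + 1)\<close>, which is at most \<open>(\<alpha> \<delta> + 1) / (\<delta> + 1)\<close>.

  No probability space is needed if the order is revealed from its end: the expected number of
  seeds in a set \<open>S\<close> is the average over \<open>v \<in> S\<close> of the value obtained when \<open>v\<close> comes last, so some
  \<open>v\<close> can be put last without exceeding the expectation, and one continues with \<open>S - {v}\<close>.
\<close>

text \<open>
  The probability that \<open>u\<close> is preceded by fewer than \<open>k u\<close> elements of \<open>N u\<close> in a uniformly
  random order of \<open>S\<close>, provided that \<open>u \<in> S\<close> and \<open>u \<notin> N u\<close>.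
\<close>
definition seed_prob :: "('a \<Rightarrow> 'a set) \<Rightarrow> ('a \<Rightarrow> nat) \<Rightarrow> 'a set \<Rightarrow> 'a \<Rightarrow> real" where
  "seed_prob N k S u = min 1 (real (k u) / (real (card (N u \<inter> S)) + 1))"

definition expected_seeds :: "('a \<Rightarrow> 'a set) \<Rightarrow> ('a \<Rightarrow> nat) \<Rightarrow> 'a set \<Rightarrow> real" where
  "expected_seeds N k S = (\<Sum>u\<in>S. seed_prob N k S u)"

lemma seed_prob_eq_1: "card (N u \<inter> S) < k u \<Longrightarrow> seed_prob N k S u = 1"
  by (simp add: seed_prob_def)

lemma seed_prob_eq_divide:
  "k u \<le> card (N u \<inter> S) + 1 \<Longrightarrow> seed_prob N k S u = real (k u) / (real (card (N u \<inter> S)) + 1)"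
  by (simp add: seed_prob_def)

lemma seed_prob_Diff_neighbor:
  assumes "finite S" "v \<in> N u \<inter> S" "k u \<le> card (N u \<inter> S)"
  shows "seed_prob N k (S - {v}) u = real (k u) / real (card (N u \<inter> S))"
proof -
  have "N u \<inter> (S - {v}) = (N u \<inter> S) - {v}"
    by blast
  then have "card (N u \<inter> S) = Suc (card (N u \<inter> (S - {v})))"
    using assms(1,2) card.remove[of "N u \<inter> S" v] by simp
  then show ?thesis
    using assms(3) by (simp add: seed_prob_eq_divide add.commute)
qed

lemma seed_prob_Diff_non_neighbor:
  "v \<notin> N u \<Longrightarrow> seed_prob N k (S - {v}) u = seed_prob N k S u"
  by (simp add: seed_prob_def flip: Int_Diff)

lemma sum_seed_prob_Diff:
  assumes "finite S" "u \<in> S" "u \<notin> N u" "k u \<le> card (N u \<inter> S)"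
  shows "(\<Sum>v\<in>S - {u}. seed_prob N k (S - {v}) u) = real (card S) * seed_prob N k S u"
proof -
  let ?d = "card (N u \<inter> S)" and ?R = "S - {u} - N u"
  have split: "S - {u} = (N u \<inter> S) \<union> ?R"
    using assms(3) by blast
  have "card (S - {u}) = ?d + card ?R"
    using assms(1) by (subst split, intro card_Un_disjoint) auto
  then have card_S: "card S = ?d + 1 + card ?R"
    using card.remove[OF assms(1,2)] by simp
  have prob_S: "seed_prob N k S u = real (k u) / (real ?d + 1)"
    using assms(4) by (simp add: seed_prob_eq_divide)
  have "(\<Sum>v\<in>S - {u}. seed_prob N k (S - {v}) u) =
      (\<Sum>v\<in>N u \<inter> S. seed_prob N k (S - {v}) u) + (\<Sum>v\<in>?R. seed_prob N k (S - {v}) u)"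
    using assms(1) by (subst split, intro sum.union_disjoint) auto
  also have "(\<Sum>v\<in>N u \<inter> S. seed_prob N k (S - {v}) u) = real ?d * (real (k u) / real ?d)"
    using assms(1,4) by (simp add: seed_prob_Diff_neighbor)
  also have "real ?d * (real (k u) / real ?d) = real (k u)"
    using assms(4) by simp \<comment> \<open>if \<open>?d = 0\<close>, then also \<open>k u = 0\<close>\<close>
  also have "(\<Sum>v\<in>?R. seed_prob N k (S - {v}) u) = real (card ?R) * seed_prob N k S u"
    by (simp add: seed_prob_Diff_non_neighbor)
  also have "real (k u) + real (card ?R) * seed_prob N k S u = real (card S) * seed_prob N k S u"
    by (simp add: prob_S card_S field_simps)
  finally show ?thesis .
qed

text \<open>Conditioning on the last element of the order: either it is \<open>u\<close>, or some other \<open>v\<close>.\<close>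
lemma card_mult_seed_prob:
  assumes "finite S" "u \<in> S" "u \<notin> N u"
  shows "real (card S) * seed_prob N k S u =
    of_bool (card (N u \<inter> S) < k u) + (\<Sum>v\<in>S - {u}. seed_prob N k (S - {v}) u)"
proof (cases "card (N u \<inter> S) < k u")
  case True
  have "seed_prob N k (S - {v}) u = 1" for v
    using True card_mono[of "N u \<inter> S" "N u \<inter> (S - {v})"] assms(1)
    by (intro seed_prob_eq_1) fastforce
  moreover have "card S = Suc (card (S - {u}))"
    using assms(1,2) by (rule card.remove)
  ultimately show ?thesis
    using True by (simp add: seed_prob_eq_1)
next
  case False
  then show ?thesis
    using assms by (simp add: sum_seed_prob_Diff)
qed

lemma card_mult_expected_seeds:
  assumes "finite S" "\<And>u. u \<in> S \<Longrightarrow> u \<notin> N u"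
  shows "real (card S) * expected_seeds N k S =
    (\<Sum>v\<in>S. of_bool (card (N v \<inter> S) < k v) + expected_seeds N k (S - {v}))"
proof -
  have Diff_eq: "S - {u} = {v \<in> S. v \<noteq> u}" for u
    by blast
  have "real (card S) * expected_seeds N k S =
      (\<Sum>u\<in>S. of_bool (card (N u \<inter> S) < k u) + (\<Sum>v\<in>S - {u}. seed_prob N k (S - {v}) u))"
    unfolding expected_seeds_def sum_distrib_left
    by (intro sum.cong refl card_mult_seed_prob assms)
  also have "\<dots> = (\<Sum>u\<in>S. of_bool (card (N u \<inter> S) < k u)) +
      (\<Sum>u\<in>S. \<Sum>v\<in>S - {u}. seed_prob N k (S - {v}) u)"
    by (rule sum.distrib)
  also have "(\<Sum>u\<in>S. \<Sum>v\<in>S - {u}. seed_prob N k (S - {v}) u) =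
      (\<Sum>v\<in>S. \<Sum>u\<in>S - {v}. seed_prob N k (S - {v}) u)"
    using sum.swap_restrict[OF assms(1,1), of "\<lambda>u v. seed_prob N k (S - {v}) u" "\<lambda>u v. v \<noteq> u"]
    by (simp add: Diff_eq eq_commute)
  finally show ?thesis
    by (simp add: sum.distrib expected_seeds_def)
qed

lemma ex_last_expected_seeds_le:
  assumes "finite S" "S \<noteq> {}" "\<And>u. u \<in> S \<Longrightarrow> u \<notin> N u"
  shows "\<exists>v\<in>S. of_bool (card (N v \<inter> S) < k v) + expected_seeds N k (S - {v})
    \<le> expected_seeds N k S"
proof (rule ccontr)
  assume "\<not> ?thesis"
  then have "(\<Sum>v\<in>S. expected_seeds N k S) <
      (\<Sum>v\<in>S. of_bool (card (N v \<inter> S) < k v) + expected_seeds N k (S - {v}))"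
    by (intro sum_strict_mono assms) (simp add: not_le)
  then show False
    using card_mult_expected_seeds[OF assms(1,3)] by simp
qed

definition activates :: "real \<Rightarrow> ('a, 'b) pre_digraph \<Rightarrow> 'a set \<Rightarrow> 'a set \<Rightarrow> bool" where
  "activates \<alpha> G D S \<longleftrightarrow>
    (\<forall>C. (\<forall>v\<in>D. C v = Black) \<longrightarrow> (\<exists>T. \<forall>t\<ge>T. \<forall>v\<in>S. bootstrap \<alpha> G C t v = Black))"

lemma dynamo_iff_activates: "dynamo \<alpha> G D \<longleftrightarrow> D \<subseteq> verts G \<and> activates \<alpha> G D (verts G)"
  by (simp add: dynamo_def activates_def)

lemma activates_insert_seed:
  assumes "activates \<alpha> G D S"
  shows "activates \<alpha> G (insert v D) (insert v S)"
  using assms by (simp add: activates_def bootstrap_Black_mono)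

lemma activates_insert:
  assumes "activates \<alpha> G D S" "finite (neighbors G v)"
    and threshold: "\<alpha> * real (out_degree G v) \<le> real (card (neighbors G v \<inter> S))"
  shows "activates \<alpha> G D (insert v S)"
  unfolding activates_def
proof (intro allI impI)
  fix C assume "\<forall>v\<in>D. C v = Black"
  then obtain T where T: "bootstrap \<alpha> G C t u = Black" if "t \<ge> T" "u \<in> S" for t u
    using assms(1) unfolding activates_def by blast
  have "bootstrap \<alpha> G C (Suc t) v = Black" if "t \<ge> T" for t
  proof -
    have "card (neighbors G v \<inter> S) \<le> card {u \<in> neighbors G v. bootstrap \<alpha> G C t u = Black}"
      using assms(2) T[OF that] by (intro card_mono) auto
    then show ?thesis
      using threshold by (simp add: bootstrap_step_def)
  qed
  then have "\<forall>t\<ge>Suc T. \<forall>u\<in>insert v S. bootstrap \<alpha> G C t u = Black"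
    using T by (metis Suc_leD Suc_le_D Suc_le_mono insertE)
  then show "\<exists>T. \<forall>t\<ge>T. \<forall>u\<in>insert v S. bootstrap \<alpha> G C t u = Black" ..
qed

lemma add_one_div_antimono:
  fixes \<alpha> x y :: real
  assumes "\<alpha> \<le> 1" "0 \<le> x" "x \<le> y"
  shows "(\<alpha> * y + 1) / (y + 1) \<le> (\<alpha> * x + 1) / (x + 1)"
proof -
  have "0 \<le> (1 - \<alpha>) * (y - x)"
    using assms by simp
  then have "(\<alpha> * y + 1) * (x + 1) \<le> (\<alpha> * x + 1) * (y + 1)"
    by (simp add: algebra_simps)
  then show ?thesis
    using assms by (simp add: divide_simps)
qed

lemma (in wf_digraph) neighbors_subset_verts: "neighbors G v \<subseteq> verts G"
  unfolding neighbors_def using adj_in_verts(2) by blast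

lemma (in fin_digraph) finite_neighbors: "finite (neighbors G v)"
  using neighbors_subset_verts finite_verts by (rule finite_subset)

lemma (in loopfree_digraph) not_in_neighbors: "v \<notin> neighbors G v"
  unfolding neighbors_def using adj_not_same by blast

lemma (in nomulti_digraph) card_neighbors: "card (neighbors G v) = out_degree G v"
proof -
  have "neighbors G v = head G ` out_arcs G v"
    by (force simp: neighbors_def arcs_ends_def arc_to_ends_def)
  moreover have "inj_on (head G) (out_arcs G v)"
    using no_multi_arcs by (auto simp: inj_on_def arc_to_ends_def)
  ultimately show ?thesis
    unfolding out_degree_def by (simp add: card_image)
qed

lemma (in fin_digraph) min_degree_le_out_degree: "v \<in> verts G \<Longrightarrow> min_degree G \<le> out_degree G v"
  unfolding min_degree_def by simp

lemma (in fin_digraph) MD_le_card_dynamo: "dynamo \<alpha> G D \<Longrightarrow> MD \<alpha> G \<le> card D"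
  unfolding MD_def
  by (intro Min_le finite_imageI finite_subset[of "{D. dynamo \<alpha> G D}" "Pow (verts G)"])
    (auto simp: dynamo_def)

context digraph
begin

lemma ex_activating_subset:
  assumes "finite S" "\<And>v. v \<in> S \<Longrightarrow> \<alpha> * real (out_degree G v) \<le> real (k v)"
  shows "\<exists>D\<subseteq>S. activates \<alpha> G D S \<and> real (card D) \<le> expected_seeds (neighbors G) k S"
  using assms
proof (induction S rule: finite_remove_induct)
  case empty
  show ?case
    by (simp add: activates_def expected_seeds_def)
next
  case (remove S)
  obtain v where v: "v \<in> S" and expected: "of_bool (card (neighbors G v \<inter> S) < k v) +
      expected_seeds (neighbors G) k (S - {v}) \<le> expected_seeds (neighbors G) k S"
    using ex_last_expected_seeds_le[OF remove.hyps(1,2) not_in_neighbors] by blast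
  obtain D where D: "D \<subseteq> S - {v}" "activates \<alpha> G D (S - {v})"
    and card_D: "real (card D) \<le> expected_seeds (neighbors G) k (S - {v})"
    using remove.IH[OF v] remove.prems by blast
  show ?case
  proof (cases "card (neighbors G v \<inter> S) < k v")
    case True
    have "activates \<alpha> G (insert v D) S"
      using activates_insert_seed[OF D(2), of v] v by (simp add: insert_absorb)
    moreover have "real (card (insert v D)) \<le> real (card D) + 1"
      by (simp add: card_insert_if finite_subset[OF D(1)] remove.hyps)
    ultimately show ?thesis
      using D(1) v True expected card_D by (intro exI[of _ "insert v D"]) auto
  next
    case False
    have "\<alpha> * real (out_degree G v) \<le> real (k v)"
      by (rule remove.prems[OF v])
    also have "\<dots> \<le> real (card (neighbors G v \<inter> S))"
      using False by simp
    also have "neighbors G v \<inter> S = neighbors G v \<inter> (S - {v})"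
      using not_in_neighbors by blast
    finally have "activates \<alpha> G D S"
      using activates_insert[OF D(2) finite_neighbors] v by (fastforce simp: insert_absorb)
    then show ?thesis
      using D(1) False expected card_D by (intro exI[of _ D]) auto
  qed
qed

lemma MD_le_sum:
  "real (MD \<alpha> G) \<le>
    (\<Sum>v\<in>verts G. real (nat \<lceil>\<alpha> * real (out_degree G v)\<rceil>) / (real (out_degree G v) + 1))"
proof -
  let ?k = "\<lambda>v. nat \<lceil>\<alpha> * real (out_degree G v)\<rceil>"
  obtain D where "D \<subseteq> verts G" "activates \<alpha> G D (verts G)"
    and card_D: "real (card D) \<le> expected_seeds (neighbors G) ?k (verts G)"
    using ex_activating_subset[OF finite_verts real_nat_ceiling_ge] by blast
  then have "real (MD \<alpha> G) \<le> real (card D)"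
    by (simp add: MD_le_card_dynamo dynamo_iff_activates)
  also note card_D
  also have "expected_seeds (neighbors G) ?k (verts G) \<le>
      (\<Sum>v\<in>verts G. real (?k v) / (real (out_degree G v) + 1))"
    unfolding expected_seeds_def seed_prob_def
    by (intro sum_mono) (simp add: Int_absorb2 neighbors_subset_verts card_neighbors)
  finally show ?thesis .
qed

lemma MD_le_min_degree:
  assumes "0 \<le> \<alpha>" "\<alpha> \<le> 1"
  shows "real (MD \<alpha> G) \<le>
    real (card (verts G)) * ((\<alpha> * real (min_degree G) + 1) / (real (min_degree G) + 1))"
proof -
  have "real (nat \<lceil>\<alpha> * real (out_degree G v)\<rceil>) / (real (out_degree G v) + 1)
      \<le> (\<alpha> * real (min_degree G) + 1) / (real (min_degree G) + 1)" if "v \<in> verts G" for v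
  proof -
    let ?d = "real (out_degree G v)"
    have "real (nat \<lceil>\<alpha> * ?d\<rceil>) \<le> \<alpha> * ?d + 1"
      using assms(1) by simp
    then have "real (nat \<lceil>\<alpha> * ?d\<rceil>) / (?d + 1) \<le> (\<alpha> * ?d + 1) / (?d + 1)"
      by (intro divide_right_mono) auto
    also have "\<dots> \<le> (\<alpha> * real (min_degree G) + 1) / (real (min_degree G) + 1)"
      using assms(2) min_degree_le_out_degree[OF that] by (intro add_one_div_antimono) auto
    finally show ?thesis .
  qed
  then show ?thesis
    by (intro order.trans[OF MD_le_sum] sum_bounded_above)
qed

end

lemma (in wf_digraph) bootstrap_all_White:
  assumes "0 < \<alpha>" "\<And>v. v \<in> verts G \<Longrightarrow> 0 < out_degree G v" "v \<in> verts G"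
  shows "bootstrap \<alpha> G (\<lambda>_. White) t v = White"
  using assms(3)
proof (induction t arbitrary: v)
  case (Suc t)
  have "{u \<in> neighbors G v. bootstrap \<alpha> G (\<lambda>_. White) t u = Black} = {}"
    using Suc.IH neighbors_subset_verts by fastforce
  moreover have "0 < \<alpha> * real (out_degree G v)"
    using assms(1) assms(2)[OF Suc.prems] by simp
  ultimately show ?case
    using Suc.IH[OF Suc.prems] by (simp add: bootstrap_step_def del: Collect_empty_eq)
qed simp

lemma (in fin_digraph) MD_pos:
  assumes "0 < \<alpha>" "verts G \<noteq> {}" "\<And>v. v \<in> verts G \<Longrightarrow> 0 < out_degree G v"
  shows "0 < MD \<alpha> G"
proof -
  obtain D where D: "dynamo \<alpha> G D" "card D = MD \<alpha> G"
    using MD_attained[OF finite_verts] by blast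
  have "D \<noteq> {}"
  proof
    assume "D = {}"
    then obtain t where "\<forall>v\<in>verts G. bootstrap \<alpha> G (\<lambda>_. White) t v = Black"
      using D(1) unfolding dynamo_def by blast
    then show False
      using assms(2) bootstrap_all_White[OF assms(1,3)] by fastforce
  qed
  moreover have "finite D"
    using D(1) finite_subset[OF _ finite_verts] by (simp add: dynamo_def)
  ultimately show ?thesis
    by (simp add: card_gt_0_iff flip: D(2))
qed

lemma (in graph) connected_out_degree_pos:
  assumes "Digraph_Component.connected G" "2 \<le> card (verts G)" "u \<in> verts G"
  shows "0 < out_degree G u"
proof -
  have "\<not> verts G \<subseteq> {u}"
    using assms(2) card_mono[of "{u}" "verts G"] by auto
  then obtain v where v: "v \<in> verts G" "v \<noteq> u"
    by blast
  have "u \<rightarrow>\<^sup>*\<^bsub>G\<^esub> v"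
    using symmetric_connected_imp_strongly_connected[OF sym_arcs assms(1)] assms(3) v(1) by blast
  then obtain w where "u \<rightarrow>\<^bsub>G\<^esub> w"
    using v(2) by (metis converse_reachable_cases)
  then have "neighbors G u \<noteq> {}"
    by (auto simp: neighbors_def)
  then show ?thesis
    using finite_neighbors by (simp add: card_gt_0_iff flip: card_neighbors)
qed

theorem theorem1:
  fixes G :: "('a, 'b) pre_digraph" and \<alpha> :: real and n \<delta> :: nat
  assumes "0 < \<alpha>" and "\<alpha> < 1"
    and "graph G" and "Digraph_Component.connected G"
    and "n = card (verts G)" and "\<delta> = min_degree G"
  shows "(n \<ge> 2 \<longrightarrow> 1 \<le> MD \<alpha> G) \<and>
    real (MD \<alpha> G) \<le> ((real \<delta> + 1 / \<alpha>) / (real \<delta> + 1)) * \<alpha> * real n"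
proof (intro conjI impI)
  interpret graph G by fact
  show "1 \<le> MD \<alpha> G" if "n \<ge> 2"
  proof -
    have "verts G \<noteq> {}"
      using that assms(5) by auto
    then have "0 < MD \<alpha> G"
      using assms(1,4,5) that by (intro MD_pos connected_out_degree_pos) auto
    then show ?thesis
      by simp
  qed
  have "(real \<delta> + 1 / \<alpha>) / (real \<delta> + 1) * \<alpha> = (\<alpha> * real \<delta> + 1) / (real \<delta> + 1)"
    using assms(1) by (simp add: distrib_right)
  then show "real (MD \<alpha> G) \<le> ((real \<delta> + 1 / \<alpha>) / (real \<delta> + 1)) * \<alpha> * real n"
    using MD_le_min_degree[of \<alpha>] assms(1,2,5,6) by (simp add: mult.commute)
qed

end
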